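(* Let $\lambda$ be a charge of bounded variation on a measurable space $(X,\mathcal{A})$. Let $\beta=\inf_{A\in\mathcal{A}}\lambda(A)$, and let $(E_k)_{k\ge 1}$ be a sequence of sets in $\mathcal{A}$ such that $\lambda(E_k)<\beta+\epsilon_k$ for all $k$, where $\epsilon_k>0$ and $\sum_k\epsilon_k<\infty$. Put $$X_m=\bigcap_{k\ge m}E_k\quad (m\ge 1),\qquad X_-=\bigcup_{m\ge 1}X_m,\qquad X_+=X\setminus X_-.$$ Then the pair $X_-,X_+$ is a Hahn decomposition corresponding to $\lambda$.
   Context: A charge of bounded variation is a (countably additive) finite signed measure. A Hahn decomposition corresponding to $\lambda$ is a representation of $X$ as a disjoint union of two measurable sets $X_-$ and $X_+$ such that $\lambda(A)\ge 0$ for all measurable $A\subset X_+$ and $\lambda(A)\le 0$ for all measurable $A\subset X_-$. *)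

theory Defs
  imports "HOL-Analysis.Analysis"
begin

text \<open>
  The library has no signed measures (its \<^const>\<open>countably_additive\<close> is restricted to
  \<^typ>\<open>ennreal\<close>-valued set functions).  Finiteness is expressed by the type of values
  \<^typ>\<open>real\<close>.  The union of the family does not depend on the order of its members, so the
  series in the definition converges absolutely.
\<close>

definition finite_signed_measure :: "'a set \<Rightarrow> 'a set set \<Rightarrow> ('a set \<Rightarrow> real) \<Rightarrow> bool" where
  "finite_signed_measure X \<A> \<mu> \<longleftrightarrow>
     sigma_algebra X \<A> \<and> \<mu> {} = 0 \<and>
     (\<forall>A :: nat \<Rightarrow> 'a set. range A \<subseteq> \<A> \<and> disjoint_family A \<longrightarrow>
        (\<lambda>n. \<mu> (A n)) sums \<mu> (\<Union>n. A n))"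

definition hahn_decomposition ::
    "'a set \<Rightarrow> 'a set set \<Rightarrow> ('a set \<Rightarrow> real) \<Rightarrow> 'a set \<Rightarrow> 'a set \<Rightarrow> bool" where
  "hahn_decomposition X \<A> \<mu> X_neg X_pos \<longleftrightarrow>
     X_neg \<in> \<A> \<and> X_pos \<in> \<A> \<and> X_neg \<union> X_pos = X \<and> X_neg \<inter> X_pos = {} \<and>
     (\<forall>A\<in>\<A>. A \<subseteq> X_pos \<longrightarrow> \<mu> A \<ge> 0) \<and>
     (\<forall>A\<in>\<A>. A \<subseteq> X_neg \<longrightarrow> \<mu> A \<le> 0)"

end

theory Submission
  imports Defs
begin

text \<open>
  A set \<open>E\<close> whose charge exceeds the infimum \<open>\<beta>\<close> by less than \<open>e\<close> is nearly a negative set with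
  nearly positive complement: a measurable part of \<open>E\<close> of charge at least \<open>e\<close> could be removed
  from \<open>E\<close>, and a measurable set disjoint from \<open>E\<close> of charge at most \<open>-e\<close> could be added to it,
  and either change would bring the charge below \<open>\<beta>\<close>
  (\<open>charge_of_subset_of_near_minimizer\<close>, \<open>charge_outside_near_minimizer\<close>).

  A measurable part of \<open>X_m\<close> lies in all \<open>E_k\<close> with \<open>k \<ge> m\<close>, so its charge is below every such
  \<open>\<epsilon>_k\<close>, hence at most \<open>0\<close>; countable additivity carries this over to the union \<open>X_-\<close>.  A
  measurable set \<open>A\<close> inside \<open>X_+\<close> meets no \<open>X_m\<close>, so for each \<open>m\<close> it is covered by the
  complements of the \<open>E_k\<close> with \<open>k \<ge> m\<close>.  Making this cover disjoint gives
  \<open>\<mu> A \<ge> - (\<Sum>k\<ge>m. \<epsilon>_k)\<close>, and the tail of the convergent series vanishes as \<open>m\<close> grows.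

  All of this presupposes that \<open>\<beta>\<close> is a true lower bound, that is, that a countably additive
  real-valued set function is bounded.  This is \<open>bounded_charge\<close>: otherwise unboundedness could
  be localised to ever smaller sets, cutting off at each step a piece of charge at least \<open>1\<close> in
  absolute value, against the convergence of the series of charges of these disjoint pieces.
\<close>

section \<open>Finite signed measures\<close>

locale signed_measure_space =
  fixes X :: "'a set" and \<A> :: "'a set set" and \<mu> :: "'a set \<Rightarrow> real"
  assumes signed_measure: "finite_signed_measure X \<A> \<mu>"
begin

sublocale sigma_algebra X \<A>
  using signed_measure by (simp add: finite_signed_measure_def)

lemma charge_empty: "\<mu> {} = 0"
  using signed_measure by (simp add: finite_signed_measure_def)

lemma charge_sums:
  fixes A :: "nat \<Rightarrow> 'a set"
  assumes "range A \<subseteq> \<A>" "disjoint_family A"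
  shows "(\<lambda>n. \<mu> (A n)) sums \<mu> (\<Union>n. A n)"
  using signed_measure assms unfolding finite_signed_measure_def by blast

lemma charge_Un:
  assumes "A \<in> \<A>" "B \<in> \<A>" "A \<inter> B = {}"
  shows "\<mu> (A \<union> B) = \<mu> A + \<mu> B"
proof -
  have "range (binaryset A B) \<subseteq> \<A>"
    using assms by (auto simp: range_binaryset_eq)
  moreover have "disjoint_family (binaryset A B)"
    using assms by (auto simp: disjoint_family_on_def binaryset_def)
  ultimately have "(\<lambda>n. \<mu> (binaryset A B n)) sums \<mu> (A \<union> B)"
    using charge_sums[of "binaryset A B"] by (simp add: UN_binaryset_eq)
  moreover have "(\<lambda>n. \<mu> (binaryset A B n)) sums (\<mu> A + \<mu> B)"
    by (rule binaryset_sums) (rule charge_empty)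
  ultimately show ?thesis
    by (rule sums_unique2)
qed

lemma charge_Diff:
  assumes "A \<in> \<A>" "B \<in> \<A>" "B \<subseteq> A"
  shows "\<mu> (A - B) = \<mu> A - \<mu> B"
  using charge_Un[of B "A - B"] assms by (simp add: Un_absorb1 Diff)

text \<open>
  The signed-measure substitute for countable subadditivity: bounds on the charges of measurable
  parts of the single \<open>F n\<close> pass to \<open>\<mu> A\<close> by summation.
\<close>

lemma disjoint_refinement_of_cover:
  fixes F :: "nat \<Rightarrow> 'a set"
  assumes "A \<in> \<A>" "range F \<subseteq> \<A>" "A \<subseteq> (\<Union>n. F n)"
  obtains D where "\<And>n. D n \<in> \<A>" "\<And>n. D n \<subseteq> A \<inter> F n" "(\<lambda>n. \<mu> (D n)) sums \<mu> A"
proof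
  let ?D = "disjointed (\<lambda>n. A \<inter> F n)"
  have meas: "range ?D \<subseteq> \<A>"
    using assms by (intro range_disjointed_sets) auto
  then show "?D n \<in> \<A>" for n
    by auto
  show "?D n \<subseteq> A \<inter> F n" for n
    by (rule disjointed_subset)
  have "(\<Union>n. ?D n) = A"
    using assms by (auto simp: UN_disjointed_eq)
  then show "(\<lambda>n. \<mu> (?D n)) sums \<mu> A"
    using charge_sums[OF meas disjoint_family_disjointed] by simp
qed

section \<open>Boundedness\<close>

definition bounded_within :: "'a set \<Rightarrow> bool" where
  "bounded_within A \<longleftrightarrow> (\<exists>c. \<forall>B\<in>\<A>. B \<subseteq> A \<longrightarrow> \<bar>\<mu> B\<bar> \<le> c)"

lemma bounded_within_split:
  assumes "B \<in> \<A>" "bounded_within B" "bounded_within (A - B)"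
  shows "bounded_within A"
proof -
  obtain a b where a: "\<And>C. C \<in> \<A> \<Longrightarrow> C \<subseteq> B \<Longrightarrow> \<bar>\<mu> C\<bar> \<le> a"
    and b: "\<And>C. C \<in> \<A> \<Longrightarrow> C \<subseteq> A - B \<Longrightarrow> \<bar>\<mu> C\<bar> \<le> b"
    using assms(2,3) unfolding bounded_within_def by metis
  have "\<bar>\<mu> C\<bar> \<le> a + b" if "C \<in> \<A>" "C \<subseteq> A" for C
  proof -
    have "\<mu> C = \<mu> (C \<inter> B) + \<mu> (C - B)"
      using charge_Un[of "C \<inter> B" "C - B"] that assms(1)
      by (simp add: Int_Diff_Un Int_Diff_disjoint Int Diff)
    moreover have "\<bar>\<mu> (C \<inter> B)\<bar> \<le> a" "\<bar>\<mu> (C - B)\<bar> \<le> b"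
      using that assms(1) by (auto intro!: a b)
    ultimately show ?thesis
      by linarith
  qed
  then show ?thesis
    unfolding bounded_within_def by blast
qed

text \<open>
  A part \<open>B\<close> whose charge is much larger than that of \<open>A\<close> forces \<open>A - B\<close> to have large charge as
  well.  One of these two pieces inherits the unboundedness, and the other one is cut off.
\<close>

lemma unbounded_within_cut:
  assumes "A \<in> \<A>" "\<not> bounded_within A"
  obtains B where "B \<in> \<A>" "B \<subseteq> A" "\<not> bounded_within B" "1 \<le> \<bar>\<mu> (A - B)\<bar>"
proof -
  have "\<exists>B\<in>\<A>. B \<subseteq> A \<and> \<bar>\<mu> B\<bar> > 1 + \<bar>\<mu> A\<bar>"
    using assms(2) unfolding bounded_within_def by (meson not_le)
  then obtain B where B: "B \<in> \<A>" "B \<subseteq> A" "\<bar>\<mu> B\<bar> > 1 + \<bar>\<mu> A\<bar>"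
    by blast
  have large: "1 \<le> \<bar>\<mu> (A - B)\<bar>"
    using charge_Diff[OF assms(1) B(1,2)] B(3) by linarith
  show thesis
  proof (cases "bounded_within B")
    case False
    then show ?thesis
      using B large by (intro that[of B]) auto
  next
    case True
    then have "\<not> bounded_within (A - B)"
      using bounded_within_split[OF B(1)] assms(2) by blast
    moreover have "A - (A - B) = B"
      using B(2) by blast
    ultimately show ?thesis
      using B assms(1) by (intro that[of "A - B"]) auto
  qed
qed

lemma bounded_charge: "bounded (\<mu> ` \<A>)"
proof (rule ccontr)
  assume unbounded: "\<not> bounded (\<mu> ` \<A>)"
  have "\<not> bounded_within X"
  proof
    assume "bounded_within X"
    then obtain c where "\<forall>B\<in>\<A>. B \<subseteq> X \<longrightarrow> \<bar>\<mu> B\<bar> \<le> c"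
      unfolding bounded_within_def by (elim exE)
    then have "\<forall>x\<in>\<mu> ` \<A>. \<bar>x\<bar> \<le> c"
      by (simp add: sets_into_space)
    with unbounded show False
      unfolding bounded_real by (elim notE) (rule exI)
  qed
  then have start: "\<exists>A. A \<in> \<A> \<and> \<not> bounded_within A"
    by (intro exI[of _ X] conjI top)
  have step: "\<exists>B. (B \<in> \<A> \<and> \<not> bounded_within B) \<and> (B \<subseteq> A \<and> 1 \<le> \<bar>\<mu> (A - B)\<bar>)"
    if "A \<in> \<A> \<and> \<not> bounded_within A" for A
    using unbounded_within_cut[of A] that by metis
  have "\<exists>S. \<forall>n::nat. (S n \<in> \<A> \<and> \<not> bounded_within (S n)) \<and>
      (S (Suc n) \<subseteq> S n \<and> 1 \<le> \<bar>\<mu> (S n - S (Suc n))\<bar>)"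
    by (rule dependent_nat_choice[where P = "\<lambda>_ A. A \<in> \<A> \<and> \<not> bounded_within A"])
      (fact start, rule step)
  then obtain S :: "nat \<Rightarrow> 'a set" where "\<forall>n. (S n \<in> \<A> \<and> \<not> bounded_within (S n)) \<and>
      (S (Suc n) \<subseteq> S n \<and> 1 \<le> \<bar>\<mu> (S n - S (Suc n))\<bar>)"
    by (elim exE)
  then have S: "\<And>n. S n \<in> \<A>" "\<And>n. S (Suc n) \<subseteq> S n"
    and large: "\<And>n. 1 \<le> \<bar>\<mu> (S n - S (Suc n))\<bar>"
    by simp_all
  let ?C = "\<lambda>n. S n - S (Suc n)"
  have "decseq S"
    using S(2) by (rule decseq_SucI)
  then have disj: "?C m \<inter> ?C n = {}" if "m < n" for m n
    using that decseqD[of S "Suc m" n] by auto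
  have "disjoint_family ?C"
    unfolding disjoint_family_on_def
  proof (intro ballI impI)
    fix m n :: nat
    assume "m \<noteq> n"
    then show "?C m \<inter> ?C n = {}"
      using disj[of m n] disj[of n m] by (metis inf_commute linorder_neqE_nat)
  qed
  then have "(\<lambda>n. \<mu> (?C n)) sums \<mu> (\<Union>n. ?C n)"
    using S(1) by (intro charge_sums) auto
  then have "(\<lambda>n. \<mu> (?C n)) \<longlonglongrightarrow> 0"
    by (intro summable_LIMSEQ_zero sums_summable)
  then have "\<forall>\<^sub>F n in sequentially. \<bar>\<mu> (?C n)\<bar> < 1"
    by (auto dest!: tendstoD[where e = 1] simp: dist_real_def)
  then obtain n where "\<bar>\<mu> (?C n)\<bar> < 1"
    by (auto simp: eventually_sequentially)
  then show False
    using large[of n] by linarith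
qed

section \<open>Sets of nearly minimal charge\<close>

lemma INF_charge_le:
  assumes "A \<in> \<A>"
  shows "(INF B\<in>\<A>. \<mu> B) \<le> \<mu> A"
  using assms bounded_charge by (intro cINF_lower bounded_imp_bdd_below)

lemma charge_of_subset_of_near_minimizer:
  assumes "E \<in> \<A>" "\<mu> E < (INF B\<in>\<A>. \<mu> B) + e" "A \<in> \<A>" "A \<subseteq> E"
  shows "\<mu> A < e"
  using INF_charge_le[of "E - A"] charge_Diff[of E A] assms by fastforce

lemma charge_outside_near_minimizer:
  assumes "E \<in> \<A>" "\<mu> E < (INF B\<in>\<A>. \<mu> B) + e" "A \<in> \<A>" "A \<inter> E = {}"
  shows "- e < \<mu> A"
  using INF_charge_le[of "A \<union> E"] charge_Un[of A E] assms by fastforce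

end

section \<open>The decomposition\<close>

theorem theorem2p1:
  fixes X :: "'a set" and \<A> :: "'a set set" and \<mu> :: "'a set \<Rightarrow> real"
    and \<beta> :: real and E :: "nat \<Rightarrow> 'a set" and \<epsilon> :: "nat \<Rightarrow> real"
    and Xm :: "nat \<Rightarrow> 'a set" and X_neg X_pos :: "'a set"
  assumes "finite_signed_measure X \<A> \<mu>"
    and "\<beta> = (INF A\<in>\<A>. \<mu> A)"
    and "\<And>k. k \<ge> 1 \<Longrightarrow> E k \<in> \<A>"
    and "\<And>k. k \<ge> 1 \<Longrightarrow> \<epsilon> k > 0"
    and "summable (\<lambda>k. \<epsilon> (Suc k))"
    and "\<And>k. k \<ge> 1 \<Longrightarrow> \<mu> (E k) < \<beta> + \<epsilon> k"
    and "\<And>m. m \<ge> 1 \<Longrightarrow> Xm m = (\<Inter>k\<in>{m..}. E k)"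
    and "X_neg = (\<Union>m\<in>{1..}. Xm m)"
    and "X_pos = X - X_neg"
  shows "hahn_decomposition X \<A> \<mu> X_neg X_pos"
proof -
  interpret signed_measure_space X \<A> \<mu>
    using assms(1) by unfold_locales
  note E_meas = assms(3) and Xm_eq = assms(7) and X_neg_eq = assms(8)
  have near_min: "\<mu> (E k) < (INF A\<in>\<A>. \<mu> A) + \<epsilon> k" if "k \<ge> 1" for k
    using assms(2) assms(6)[OF that] by simp
  have \<epsilon>_lim: "(\<lambda>k. \<epsilon> (Suc k)) \<longlonglongrightarrow> 0"
    using assms(5) by (rule summable_LIMSEQ_zero)
  have Xm_meas: "Xm m \<in> \<A>" if "m \<ge> 1" for m
    unfolding Xm_eq[OF that] using that E_meas by (intro countable_INT') auto
  have neg_meas: "X_neg \<in> \<A>"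
    unfolding X_neg_eq using Xm_meas by (intro countable_UN'') auto
  have pos_meas: "X_pos \<in> \<A>"
    using neg_meas assms(9) by auto

  have neg_part: "\<mu> A \<le> 0" if A: "A \<in> \<A>" "A \<subseteq> Xm m" and m: "m \<ge> 1" for A m
  proof (rule LIMSEQ_le_const[OF \<epsilon>_lim], intro exI allI impI)
    fix k
    assume "m \<le> k"
    then have "A \<subseteq> E (Suc k)"
      using A(2) unfolding Xm_eq[OF m] by auto
    then show "\<mu> A \<le> \<epsilon> (Suc k)"
      using charge_of_subset_of_near_minimizer[OF E_meas near_min A(1)] by fastforce
  qed
  have neg: "\<mu> A \<le> 0" if A: "A \<in> \<A>" "A \<subseteq> X_neg" for A
  proof -
    have "X_neg = (\<Union>n. Xm (Suc n))"
      unfolding X_neg_eq by (auto simp: Suc_le_eq gr0_conv_Suc)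
    with A(2) have cover: "A \<subseteq> (\<Union>n. Xm (Suc n))"
      by simp
    have "range (\<lambda>n. Xm (Suc n)) \<subseteq> \<A>"
      using Xm_meas by auto
    then obtain D where D: "\<And>n. D n \<in> \<A>" "\<And>n. D n \<subseteq> A \<inter> Xm (Suc n)" "(\<lambda>n. \<mu> (D n)) sums \<mu> A"
      by (rule disjoint_refinement_of_cover[OF A(1) _ cover]) (rule that)
    have "\<mu> (D n) \<le> 0" for n
      using D(1,2)[of n] by (intro neg_part[of _ "Suc n"]) auto
    then show ?thesis
      using sums_le[OF _ D(3) sums_zero] by blast
  qed

  have pos: "0 \<le> \<mu> A" if A: "A \<in> \<A>" "A \<subseteq> X_pos" for A
  proof -
    have tail_bound: "- (\<Sum>n. \<epsilon> (Suc (n + m))) \<le> \<mu> A" for m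
    proof -
      have cover: "A \<subseteq> (\<Union>n. X - E (Suc (n + m)))"
      proof
        fix x
        assume "x \<in> A"
        then have "x \<in> X" "x \<notin> Xm (Suc m)"
          using A(2) assms(9) unfolding X_neg_eq by auto
        then obtain k where k: "k \<ge> Suc m" "x \<notin> E k"
          using Xm_eq[of "Suc m"] by auto
        \<comment> \<open>the cover is indexed from \<open>0\<close> and starts at \<open>E (Suc m)\<close>\<close>
        then have "Suc ((k - Suc m) + m) = k"
          by simp
        with k(2) \<open>x \<in> X\<close> show "x \<in> (\<Union>n. X - E (Suc (n + m)))"
          by (metis DiffI UN_I UNIV_I)
      qed
      have "range (\<lambda>n. X - E (Suc (n + m))) \<subseteq> \<A>"
        using E_meas by auto
      then obtain D where D: "\<And>n. D n \<in> \<A>" "\<And>n. D n \<subseteq> A \<inter> (X - E (Suc (n + m)))"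
          "(\<lambda>n. \<mu> (D n)) sums \<mu> A"
        by (rule disjoint_refinement_of_cover[OF A(1) _ cover]) (rule that)
      have "- \<epsilon> (Suc (n + m)) \<le> \<mu> (D n)" for n
      proof -
        have "D n \<inter> E (Suc (n + m)) = {}"
          using D(2)[of n] by blast
        then show ?thesis
          using charge_outside_near_minimizer[OF E_meas near_min D(1)] by fastforce
      qed
      moreover have "(\<lambda>n. - \<epsilon> (Suc (n + m))) sums - (\<Sum>n. \<epsilon> (Suc (n + m)))"
        using summable_ignore_initial_segment[OF assms(5), of m]
        by (intro sums_minus summable_sums)
      ultimately show ?thesis
        using D(3) by (rule sums_le)
    qed
    have "(\<lambda>m. - (\<Sum>n. \<epsilon> (Suc (n + m)))) \<longlonglongrightarrow> - 0"
      by (intro tendsto_minus suminf_exist_split2 assms(5))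
    then show ?thesis
      using tail_bound by (intro LIMSEQ_le_const2) auto
  qed

  have "X_neg \<union> X_pos = X" "X_neg \<inter> X_pos = {}"
    using neg_meas sets_into_space assms(9) by blast+
  with neg_meas pos_meas neg pos show ?thesis
    unfolding hahn_decomposition_def by blast
qed

end
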